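(* Suppose $(X,\tau,<)$ is a GO-space with a $\sigma$-closed-discrete dense subset. If $X$ has a monotone closure-preserving operator, then $(X,\tau)$ is metrizable.
   Context: A GO-space $(X,\tau,<)$ is a linearly ordered set $(X,<)$ with a Hausdorff topology $\tau$ having a base of order-convex sets. A subset of a space is $\sigma$-closed-discrete if it is a countable union of closed discrete subsets of that space (here with respect to $\tau$). A family $\mathcal A$ refines a family $\mathcal B$ if every $A\in\mathcal A$ is contained in some $B\in\mathcal B$. A family $\mathcal F$ of subsets of $X$ is closure-preserving if $\overline{\bigcup\mathcal H}=\bigcup\{\overline H:H\in\mathcal H\}$ for every $\mathcal H\subseteq\mathcal F$. A monotone closure-preserving operator for $X$ is a function $r$ assigning to every open cover $\mathcal U$ of $X$ a closure-preserving cover $r(\mathcal U)$ of $X$ (by arbitrary subsets) that refines $\mathcal U$, such that whenever $\mathcal U,\mathcal V$ are open covers and $\mathcal U$ refines $\mathcal V$, then $r(\mathcal U)$ refines $r(\mathcal V)$. *)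

theory Defs
  imports "HOL-Analysis.Analysis"
begin

text \<open>
  The ordered set \<open>(X, <)\<close> is \<open>topspace T\<close> with the order inherited from the linearly ordered
  type; convexity is therefore relative to \<open>topspace T\<close>, not to the whole type.
\<close>

definition order_convex_in :: "'a::linorder set \<Rightarrow> 'a set \<Rightarrow> bool" where
  "order_convex_in X C \<longleftrightarrow>
     C \<subseteq> X \<and> (\<forall>a\<in>C. \<forall>b\<in>C. \<forall>x\<in>X. a \<le> x \<and> x \<le> b \<longrightarrow> x \<in> C)"

definition GO_space :: "'a::linorder topology \<Rightarrow> bool" where
  "GO_space T \<longleftrightarrow>
     Hausdorff_space T \<and>
     (\<exists>\<B>. (\<forall>C\<in>\<B>. order_convex_in (topspace T) C) \<and>
          openin T = arbitrary union_of (\<lambda>C. C \<in> \<B>))"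

definition closed_discrete_in :: "'a topology \<Rightarrow> 'a set \<Rightarrow> bool" where
  "closed_discrete_in T D \<longleftrightarrow> closedin T D \<and> subtopology T D = discrete_topology D"

definition sigma_closed_discrete_in :: "'a topology \<Rightarrow> 'a set \<Rightarrow> bool" where
  "sigma_closed_discrete_in T S \<longleftrightarrow>
     (\<exists>\<D>. countable \<D> \<and> (\<forall>D\<in>\<D>. closed_discrete_in T D) \<and> S = \<Union>\<D>)"

definition refines :: "'a set set \<Rightarrow> 'a set set \<Rightarrow> bool" where
  "refines \<A> \<B> \<longleftrightarrow> (\<forall>A\<in>\<A>. \<exists>B\<in>\<B>. A \<subseteq> B)"

definition open_cover :: "'a topology \<Rightarrow> 'a set set \<Rightarrow> bool" where
  "open_cover T \<U> \<longleftrightarrow> (\<forall>U\<in>\<U>. openin T U) \<and> \<Union>\<U> = topspace T"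

definition closure_preserving :: "'a topology \<Rightarrow> 'a set set \<Rightarrow> bool" where
  "closure_preserving T \<F> \<longleftrightarrow>
     (\<forall>\<H>\<subseteq>\<F>. T closure_of (\<Union>\<H>) = (\<Union>H\<in>\<H>. T closure_of H))"

text \<open>Values of \<open>r\<close> at families that are not open covers are irrelevant.\<close>

definition monotone_closure_preserving_operator ::
    "'a topology \<Rightarrow> ('a set set \<Rightarrow> 'a set set) \<Rightarrow> bool" where
  "monotone_closure_preserving_operator T r \<longleftrightarrow>
     (\<forall>\<U>. open_cover T \<U> \<longrightarrow>
        \<Union>(r \<U>) = topspace T \<and> closure_preserving T (r \<U>) \<and> refines (r \<U>) \<U>) \<and>
     (\<forall>\<U> \<V>. open_cover T \<U> \<and> open_cover T \<V> \<and> refines \<U> \<V> \<longrightarrow> refines (r \<U>) (r \<V>))"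

end

theory Submission
  imports Defs
begin

text \<open>
  Let \<open>D\<^sub>0, D\<^sub>1, \<dots>\<close> be closed discrete sets with dense union. If \<open>[x, \<rightarrow>)\<close> is open, the operator
  applied to the cover \<open>{(\<leftarrow>, x), [x, \<rightarrow>)}\<close> has, by closure preservation, a member whose closure
  contains \<open>x\<close> and which contains a point of some \<open>D\<^sub>n\<close> to the right of \<open>x\<close>. Monotonicity implies that
  the points \<open>x\<close> belonging to a fixed \<open>n\<close> do not accumulate at any point from the right. Hence each is
  followed by a gap containing a point of some \<open>D\<^sub>m\<close>, and those with a fixed \<open>m\<close> form a closed discrete
  set. So the points with \<open>[x, \<rightarrow>)\<close> or \<open>(\<leftarrow>, x]\<close> open lie in a \<open>\<sigma>\<close>-closed-discrete set, which
  makes the space metrizable (Faber): every closed discrete set \<open>Z\<close> of the enlarged dense set is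
  a zero set, and collapsing it to a point gives a hedgehog with a spine for each convex
  component of the complement; these hedgehog pseudometrics, together with two-valued ones for the
  cuts at the points where a closed ray is open, induce the topology.
\<close>

subsection \<open>Hedgehog pseudometrics\<close>

definition continuous_pseudometric :: "'a topology \<Rightarrow> ('a \<Rightarrow> 'a \<Rightarrow> real) \<Rightarrow> bool" where
  "continuous_pseudometric T \<rho> \<longleftrightarrow>
     (\<forall>x y. 0 \<le> \<rho> x y \<and> \<rho> x y = \<rho> y x) \<and> (\<forall>x. \<rho> x x = 0) \<and>
     (\<forall>x y z. \<rho> x z \<le> \<rho> x y + \<rho> y z) \<and>
     (\<forall>x\<in>topspace T. \<forall>e>0. \<exists>U. openin T U \<and> x \<in> U \<and> (\<forall>y\<in>U. \<rho> x y < e))"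

text \<open>The sum with weights \<open>(1/2)^n\<close> metrizes the topology: single terms bound it
  from below, finitely many terms and a small tail from above. Two pseudometrics per neighbourhood
  are allowed because in an ordered space one will control the right side of a point and another the
  left side.\<close>

lemma metrizable_space_if_pseudometrics:
  fixes \<P> :: "('a \<Rightarrow> 'a \<Rightarrow> real) set"
  assumes "Hausdorff_space T" "countable \<P>" "\<P> \<noteq> {}"
    and \<P>: "\<And>\<rho>. \<rho> \<in> \<P> \<Longrightarrow> continuous_pseudometric T \<rho>" "\<And>\<rho> x y. \<rho> \<in> \<P> \<Longrightarrow> \<rho> x y \<le> 1"
    and sep: "\<And>U x. \<lbrakk>openin T U; x \<in> U\<rbrakk> \<Longrightarrow> \<exists>\<rho>\<in>\<P>. \<exists>\<sigma>\<in>\<P>. \<exists>e>0. \<forall>y\<in>topspace T.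
      \<rho> x y < e \<and> \<sigma> x y < e \<longrightarrow> y \<in> U"
  shows "metrizable_space T"
proof -
  define \<rho> where "\<rho> = from_nat_into \<P>"
  have range: "range \<rho> = \<P>"
    using assms(2,3) by (simp add: \<rho>_def range_from_nat_into)
  have mem: "\<rho> n \<in> \<P>" for n
    using range by blast
  have \<rho>: "0 \<le> \<rho> n x y" "\<rho> n x y \<le> 1" "\<rho> n x y = \<rho> n y x" "\<rho> n x x = 0"
    "\<rho> n x z \<le> \<rho> n x y + \<rho> n y z" for n x y z
    using \<P>(1)[OF mem[of n]] \<P>(2)[OF mem[of n]] by (simp_all add: continuous_pseudometric_def)
  have \<rho>_cont: "\<exists>U. openin T U \<and> x \<in> U \<and> (\<forall>y\<in>U. \<rho> n x y < e)" if "x \<in> topspace T" "0 < e" for n x e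
    using \<P>(1)[OF mem[of n], unfolded continuous_pseudometric_def,
        THEN conjunct2, THEN conjunct2, THEN conjunct2] that by blast
  define d where "d x y = (\<Sum>n. (1/2)^n * \<rho> n x y)" for x y
  have geo: "summable (\<lambda>n. (1/2::real)^n)"
    by (simp add: summable_geometric)
  have summable: "summable (\<lambda>n. (1/2)^n * \<rho> n x y)" for x y
  proof (rule summable_comparison_test'[OF geo, of 0])
    show "norm ((1/2)^n * \<rho> n x y) \<le> (1/2)^n" for n
      using \<rho>(1)[of n x y] \<rho>(2)[of n x y] by (simp add: abs_mult mult_left_le)
  qed
  have term_nonneg: "0 \<le> (1/2)^n * \<rho> n x y" for n x y
    by (intro mult_nonneg_nonneg \<rho>(1)) simp
  have term_le: "(1/2)^n * \<rho> n x y \<le> d x y" for n x y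
    using sum_le_suminf[OF summable, of "{n}" x y] term_nonneg unfolding d_def by simp
  have sep': "\<exists>m n e. 0 < e \<and> (\<forall>y\<in>topspace T. \<rho> m x y < e \<and> \<rho> n x y < e \<longrightarrow> y \<in> U)"
    if U: "openin T U" "x \<in> U" for U x
  proof -
    obtain \<phi> \<psi> e where *: "\<phi> \<in> \<P>" "\<psi> \<in> \<P>" "0 < e"
      "\<forall>y\<in>topspace T. \<phi> x y < e \<and> \<psi> x y < e \<longrightarrow> y \<in> U"
      using sep[OF U] by blast
    then obtain m n where "\<phi> = \<rho> m" "\<psi> = \<rho> n"
      unfolding range[symmetric] by blast
    with * show ?thesis
      by blast
  qed
  interpret M: Metric_space "topspace T" d
  proof
    fix x y z
    show "0 \<le> d x y"
      unfolding d_def by (rule suminf_nonneg[OF summable term_nonneg])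
    show "d x y = d y x"
      by (simp only: d_def \<rho>(3)[of _ x y])
    show "d x z \<le> d x y + d y z"
      unfolding d_def suminf_add[OF summable summable]
    proof (intro suminf_le summable summable_add)
      show "(1/2)^n * \<rho> n x z \<le> (1/2)^n * \<rho> n x y + (1/2)^n * \<rho> n y z" for n
        using mult_left_mono[OF \<rho>(5), of "(1/2)^n"] by (simp add: distrib_left)
    qed
    assume xy: "x \<in> topspace T" "y \<in> topspace T"
    show "d x y = 0 \<longleftrightarrow> x = y"
    proof
      assume "d x y = 0"
      then have "(1/2)^n * \<rho> n x y = 0" for n
        using term_le[of n x y] term_nonneg[of n x y] by linarith
      then have zero: "\<rho> n x y = 0" for n
        by simp
      show "x = y"
      proof (rule ccontr)
        assume "x \<noteq> y"
        then obtain U V where "openin T U" "x \<in> U" "y \<in> V" "disjnt U V"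
          using assms(1) xy unfolding Hausdorff_space_def by metis
        with sep'[of U x] zero xy show False
          by (auto simp: disjnt_iff)
      qed
    qed (use \<rho>(4) in \<open>simp add: d_def\<close>)
  qed
  have "openin T U \<longleftrightarrow> openin M.mtopology U" for U
  proof
    assume U: "openin T U"
    have "\<exists>r>0. M.mball x r \<subseteq> U" if x: "x \<in> U" for x
    proof -
      obtain m n e where e: "0 < e" "\<And>y. \<lbrakk>y \<in> topspace T; \<rho> m x y < e; \<rho> n x y < e\<rbrakk> \<Longrightarrow> y \<in> U"
        using sep'[OF U x] by blast
      define r where "r = min ((1/2)^m * e) ((1/2)^n * e)"
      have "y \<in> U" if "y \<in> M.mball x r" for y
      proof (rule e(2))
        show "y \<in> topspace T"
          using that by simp
        have "d x y < (1/2)^m * e" "d x y < (1/2)^n * e"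
          using that by (auto simp: r_def)
        then have "(1/2)^m * \<rho> m x y < (1/2)^m * e" "(1/2)^n * \<rho> n x y < (1/2)^n * e"
          using term_le order.strict_trans1 by blast+
        then show "\<rho> m x y < e" "\<rho> n x y < e"
          by simp_all
      qed
      then show ?thesis
        using e(1) by (intro exI[of _ r]) (auto simp: r_def)
    qed
    then show "openin M.mtopology U"
      using openin_subset[OF U] by (simp add: M.openin_mtopology)
  next
    assume U: "openin M.mtopology U"
    show "openin T U"
    proof (subst openin_subopen, intro ballI)
      fix x
      assume "x \<in> U"
      then obtain r where r: "0 < r" "M.mball x r \<subseteq> U" and x: "x \<in> topspace T"
        using U unfolding M.openin_mtopology by blast
      \<comment> \<open>The tail from index \<open>N\<close> on is at most
        \<open>2 * (1/2)^N\<close>, which is below \<open>r/2\<close>; the first \<open>N\<close>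
        terms, each below \<open>r/4\<close> before weighting, contribute at most
        \<open>r/2\<close>.\<close>
      obtain N where N: "(1/2::real)^N < r/4"
        using real_arch_pow_inv[of "r/4" "1/2"] r by auto
      have "\<forall>n. \<exists>V. openin T V \<and> x \<in> V \<and> (\<forall>y\<in>V. \<rho> n x y < r/4)"
        using \<rho>_cont[OF x, of "r/4"] r(1) by simp
      from choice[OF this] obtain V
        where V: "\<And>n. openin T (V n) \<and> x \<in> V n \<and> (\<forall>y\<in>V n. \<rho> n x y < r/4)"
        by blast
      define W where "W = (\<Inter>n\<in>{..<N}. V n) \<inter> topspace T"
      have "openin T W"
        unfolding W_def using V by (intro openin_INT) auto
      moreover have "x \<in> W"
        using V x by (simp add: W_def)
      moreover have "d x y < r" if y: "y \<in> W" for y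
      proof -
        have half: "(\<Sum>n. (1/2::real)^n) = 2"
          by (simp add: suminf_geometric)
        have "(\<Sum>n<N. (1/2)^n * \<rho> n x y) \<le> (\<Sum>n<N. (1/2)^n * (r/4))"
          using y V by (intro sum_mono mult_left_mono) (auto simp: W_def less_imp_le)
        also have "\<dots> = (\<Sum>n<N. (1/2)^n) * (r/4)"
          by (simp add: sum_distrib_right)
        also have "\<dots> \<le> 2 * (r/4)"
          using sum_le_suminf[OF geo, of "{..<N}"] half r(1) by (intro mult_right_mono) auto
        finally have head: "(\<Sum>n<N. (1/2)^n * \<rho> n x y) \<le> r/2"
          by simp
        have "(\<Sum>n. (1/2)^(n+N) * \<rho> (n+N) x y) \<le> (\<Sum>n. (1/2)^N * (1/2)^n)"
        proof (rule suminf_le)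
          show "(1/2)^(n+N) * \<rho> (n+N) x y \<le> (1/2)^N * (1/2)^n" for n
            using \<rho>(2)[of "n+N" x y] by (simp add: power_add mult.commute mult_left_le)
          show "summable (\<lambda>n. (1/2)^(n+N) * \<rho> (n+N) x y)"
            by (rule summable_ignore_initial_segment[OF summable])
          show "summable (\<lambda>n. (1/2::real)^N * (1/2)^n)"
            by (rule summable_mult[OF geo])
        qed
        also have "\<dots> = (1/2)^N * 2"
          using suminf_mult[OF geo, of "(1/2)^N"] half by simp
        finally have tail: "(\<Sum>n. (1/2)^(n+N) * \<rho> (n+N) x y) < r/2"
          using N by simp
        show ?thesis
          using suminf_split_initial_segment[OF summable, of x y N] head tail by (simp add: d_def)
      qed
      ultimately show "\<exists>W. openin T W \<and> x \<in> W \<and> W \<subseteq> U"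
        using r(2) x openin_subset by (intro exI[of _ W]) fastforce
    qed
  qed
  then have "T = M.mtopology"
    by (simp add: topology_eq)
  then show ?thesis
    unfolding metrizable_space_def using M.Metric_space_axioms by blast
qed

text \<open>
  The fibres of \<open>k\<close> are the spines, and \<open>f\<close> is the distance from the point at which they are glued.
\<close>
definition hedgehog :: "('a \<Rightarrow> 'b) \<Rightarrow> ('a \<Rightarrow> real) \<Rightarrow> 'a \<Rightarrow> 'a \<Rightarrow> real"
  where "hedgehog k f x y = (if k x = k y then \<bar>f x - f y\<bar> else f x + f y)"

lemma hedgehog_le_1: "\<lbrakk>\<And>x. 0 \<le> f x \<and> f x \<le> 1/2\<rbrakk> \<Longrightarrow> hedgehog k f x y \<le> 1"
  unfolding hedgehog_def by (smt (verit, best) field_sum_of_halves)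

text \<open>Where \<open>f x = 0\<close> the distance from \<open>x\<close> to \<open>y\<close> is
  \<open>f y\<close> whatever the spines are, so continuity of \<open>f\<close> suffices; elsewhere
  \<open>k\<close> is locally constant and the distance is locally
  \<open>|f x - f y|\<close>.\<close>

lemma continuous_pseudometric_hedgehog:
  assumes f: "continuous_map T euclideanreal f" "\<And>x. 0 \<le> f x"
    and k: "\<And>x. x \<in> topspace T \<Longrightarrow> f x = 0 \<or> (\<exists>U. openin T U \<and> x \<in> U \<and> (\<forall>y\<in>U. k y = k x))"
  shows "continuous_pseudometric T (hedgehog k f)"
  unfolding continuous_pseudometric_def
proof (intro conjI allI ballI impI)
  fix x y z
  show "0 \<le> hedgehog k f x y" "hedgehog k f x x = 0" "hedgehog k f x y = hedgehog k f y x"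
    using f(2) by (auto simp: hedgehog_def)
  show "hedgehog k f x z \<le> hedgehog k f x y + hedgehog k f y z"
    using f(2)[of x] f(2)[of y] f(2)[of z] by (auto simp: hedgehog_def)
next
  fix x and e :: real
  assume x: "x \<in> topspace T" and e: "0 < e"
  let ?V = "{y \<in> topspace T. f y \<in> {f x - e<..<f x + e}}"
  have V: "openin T ?V" "x \<in> ?V"
    using openin_continuous_map_preimage[OF f(1), of "{f x - e<..<f x + e}"] x e by auto
  from k[OF x] show "\<exists>U. openin T U \<and> x \<in> U \<and> (\<forall>y\<in>U. hedgehog k f x y < e)"
  proof
    assume "f x = 0"
    then show ?thesis
      using V f(2) by (intro exI[of _ ?V]) (auto simp: hedgehog_def abs_if)
  next
    assume "\<exists>U. openin T U \<and> x \<in> U \<and> (\<forall>y\<in>U. k y = k x)"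
    then obtain U where U: "openin T U" "x \<in> U" "\<forall>y\<in>U. k y = k x"
      by blast
    have "hedgehog k f x y < e" if "y \<in> U \<inter> ?V" for y
    proof -
      have "k x = k y"
        using U(3) that by simp
      then show ?thesis
        using that by (auto simp: hedgehog_def)
    qed
    then show ?thesis
      using U(1,2) V by (intro exI[of _ "U \<inter> ?V"]) blast
  qed
qed

subsection \<open>Generalized ordered spaces\<close>

lemma derived_set_of_emptyD:
  assumes "T derived_set_of D = {}" "openin T U" "p \<in> U"
  obtains V where "openin T V" "p \<in> V" "V \<subseteq> U" "V \<inter> D \<subseteq> {p}"
proof -
  have "p \<notin> T derived_set_of D" "p \<in> topspace T"
    using assms openin_subset by auto
  then obtain W where "openin T W" "p \<in> W" "\<And>y. y \<in> D \<Longrightarrow> y \<in> W \<Longrightarrow> y = p"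
    unfolding in_derived_set_of by metis
  with assms that[of "W \<inter> U"] show thesis
    by auto
qed

text \<open>An accumulation point would lie in \<open>D\<close> by closedness and be isolated there
  by discreteness. The form with derived sets passes directly to subsets and finite unions, so it
  replaces closed discreteness from here on.\<close>

lemma derived_set_of_closed_discrete_in:
  assumes "closed_discrete_in T D"
  shows "D \<subseteq> topspace T" "T derived_set_of D = {}"
proof -
  have clo: "closedin T D" and dis: "subtopology T D = discrete_topology D"
    using assms by (auto simp: closed_discrete_in_def)
  show sub: "D \<subseteq> topspace T"
    using clo closedin_subset by blast
  have "x \<notin> T derived_set_of D" for x
  proof
    assume x: "x \<in> T derived_set_of D"
    then have "x \<in> D"
      using clo derived_set_subset sub by blast
    moreover have "x \<in> (subtopology T D) derived_set_of D"
      using x \<open>x \<in> D\<close> by (simp add: derived_set_of_subtopology)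
    moreover have "openin (subtopology T D) {x}"
      using \<open>x \<in> D\<close> by (simp add: dis)
    ultimately show False
      by (metis in_derived_set_of singleton_iff)
  qed
  then show "T derived_set_of D = {}"
    by blast
qed

lemma closure_preservingD:
  "\<lbrakk>closure_preserving T \<F>; \<H> \<subseteq> \<F>\<rbrakk> \<Longrightarrow> T closure_of \<Union>\<H> = (\<Union>H\<in>\<H>. T closure_of H)"
  by (simp add: closure_preserving_def)

text \<open>The order is a parameter and not a type class instance, so that each result can be
  reused for the reversed order on the same topology.\<close>

locale go_order = linorder less_eq less
  for less_eq :: "'a \<Rightarrow> 'a \<Rightarrow> bool" (infix "\<sqsubseteq>" 50)
    and less :: "'a \<Rightarrow> 'a \<Rightarrow> bool" (infix "\<sqsubset>" 50) +
  fixes T :: "'a topology"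
  assumes Hausdorff: "Hausdorff_space T"
    and convex_base: "\<lbrakk>openin T U; p \<in> U\<rbrakk> \<Longrightarrow> \<exists>C. openin T C \<and> p \<in> C \<and> C \<subseteq> U \<and>
      (\<forall>a\<in>C. \<forall>b\<in>C. \<forall>y\<in>topspace T. a \<sqsubseteq> y \<longrightarrow> y \<sqsubseteq> b \<longrightarrow> y \<in> C)"
begin

lemma dual_go_order: "go_order (\<lambda>x y. y \<sqsubseteq> x) (\<lambda>x y. y \<sqsubset> x) T"
proof (intro go_order.intro dual_linorder go_order_axioms.intro Hausdorff)
  fix U p
  assume "openin T U" "p \<in> U"
  from convex_base[OF this]
  show "\<exists>C. openin T C \<and> p \<in> C \<and> C \<subseteq> U \<and>
      (\<forall>a\<in>C. \<forall>b\<in>C. \<forall>y\<in>topspace T. y \<sqsubseteq> a \<longrightarrow> b \<sqsubseteq> y \<longrightarrow> y \<in> C)"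
    by meson
qed

definition ord_convex :: "'a set \<Rightarrow> bool"
  where "ord_convex C \<longleftrightarrow> (\<forall>a\<in>C. \<forall>b\<in>C. \<forall>y\<in>topspace T. a \<sqsubseteq> y \<longrightarrow> y \<sqsubseteq> b \<longrightarrow> y \<in> C)"

lemma ord_convexD:
  "\<lbrakk>ord_convex C; a \<in> C; b \<in> C; y \<in> topspace T; a \<sqsubseteq> y; y \<sqsubseteq> b\<rbrakk> \<Longrightarrow> y \<in> C"
  unfolding ord_convex_def by blast

lemma convex_nhd:
  assumes "openin T U" "p \<in> U"
  obtains C where "openin T C" "p \<in> C" "C \<subseteq> U"
    "ord_convex C"
  using convex_base[OF assms] unfolding ord_convex_def by blast

lemma convex_nhd_avoiding:
  assumes "openin T U" "p \<in> U" "T derived_set_of D = {}"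
  obtains C where "openin T C" "p \<in> C" "C \<subseteq> U" "\<And>d. \<lbrakk>d \<in> C; d \<in> D\<rbrakk> \<Longrightarrow> d = p"
    "ord_convex C"
proof -
  obtain V where V: "openin T V" "p \<in> V" "V \<subseteq> U" "V \<inter> D \<subseteq> {p}"
    using derived_set_of_emptyD assms by metis
  obtain C where "openin T C" "p \<in> C" "C \<subseteq> V"
    "ord_convex C"
    using convex_nhd[OF V(1,2)] by blast
  with V show thesis
    by (intro that[of C]) auto
qed

text \<open>A convex neighbourhood of \<open>y \<sqsubset> x\<close> that misses \<open>x\<close>
  cannot reach beyond \<open>x\<close>, and the Hausdorff property supplies one.\<close>

lemma openin_below:
  assumes "x \<in> topspace T"
  shows "openin T {y \<in> topspace T. y \<sqsubset> x}"
proof (subst openin_subopen, intro ballI)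
  fix y
  assume "y \<in> {y \<in> topspace T. y \<sqsubset> x}"
  then have y: "y \<in> topspace T" "y \<sqsubset> x"
    by auto
  then obtain U V where UV: "openin T U" "openin T V" "y \<in> U" "x \<in> V" "disjnt U V"
    using Hausdorff assms unfolding Hausdorff_space_def by (metis less_irrefl)
  obtain C where C: "openin T C" "y \<in> C" "C \<subseteq> U"
    "ord_convex C"
    using convex_nhd[OF UV(1,3)] by blast
  have "x \<notin> C"
    using C UV by (auto simp: disjnt_iff)
  have "z \<sqsubset> x" if "z \<in> C" for z
  proof (rule ccontr)
    assume "\<not> z \<sqsubset> x"
    then have "x \<in> C"
      using ord_convexD[OF C(4,2) that assms] y by auto
    with \<open>x \<notin> C\<close> show False ..
  qed
  with C show "\<exists>C. openin T C \<and> y \<in> C \<and> C \<subseteq> {y \<in> topspace T. y \<sqsubset> x}"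
    using openin_subset by blast
qed

lemma openin_above:
  assumes "x \<in> topspace T"
  shows "openin T {y \<in> topspace T. x \<sqsubset> y}"
proof -
  interpret dual: go_order "\<lambda>x y. y \<sqsubseteq> x" "\<lambda>x y. y \<sqsubset> x" T
    by (rule dual_go_order)
  show ?thesis
    by (rule dual.openin_below[OF assms])
qed

lemma closedin_at_least:
  assumes "x \<in> topspace T"
  shows "closedin T {y \<in> topspace T. x \<sqsubseteq> y}"
proof -
  have "topspace T - {y \<in> topspace T. x \<sqsubseteq> y} = {y \<in> topspace T. y \<sqsubset> x}"
    by auto
  then show ?thesis
    using openin_below[OF assms] by (simp add: closedin_def)
qed

text \<open>A convex neighbourhood of \<open>p\<close> whose only possible point of \<open>D\<close>
  is \<open>p\<close> has at most one point of \<open>S\<close> on each side of \<open>p\<close>,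
  since two would trap another point of \<open>D\<close>. So it meets \<open>S\<close> in a finite
  set, which has no accumulation point in a Hausdorff space.\<close>

lemma derived_set_of_eq_empty_if_separated:
  assumes D: "T derived_set_of D = {}"
    and sep: "\<And>x y. \<lbrakk>x \<in> S; y \<in> S; x \<sqsubset> y\<rbrakk> \<Longrightarrow> \<exists>d\<in>D. x \<sqsubset> d \<and> d \<sqsubset> y"
    and sub: "D \<subseteq> topspace T"
  shows "T derived_set_of S = {}"
proof -
  have "p \<notin> T derived_set_of S" for p
  proof
    assume p: "p \<in> T derived_set_of S"
    then have "p \<in> topspace T"
      using in_derived_set_of by metis
    then obtain C where C: "openin T C" "p \<in> C" "C \<subseteq> topspace T" "\<And>d. \<lbrakk>d \<in> C; d \<in> D\<rbrakk> \<Longrightarrow> d = p"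
      "ord_convex C"
      using convex_nhd_avoiding[OF openin_topspace _ D] by metis
    have same_side: False if "x \<in> C \<inter> S" "y \<in> C \<inter> S" "x \<sqsubset> y" "p \<sqsubset> x \<or> y \<sqsubset> p" for x y
    proof -
      obtain d where d: "d \<in> D" "x \<sqsubset> d" "d \<sqsubset> y"
        using sep \<open>x \<in> C \<inter> S\<close> \<open>y \<in> C \<inter> S\<close> \<open>x \<sqsubset> y\<close> by blast
      have "d \<in> topspace T"
        using sub d by blast
      then have "d \<in> C"
        using ord_convexD[OF C(5), of x y d] that d by auto
      then have "d = p"
        using C(4) d by blast
      with that d show False
        by auto
    qed
    have "finite (C \<inter> S)"
    proof -
      have "\<exists>a. {x \<in> C \<inter> S. p \<sqsubset> x} \<subseteq> {a}"
        using same_side less_linear by blast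
      moreover have "\<exists>b. {x \<in> C \<inter> S. x \<sqsubset> p} \<subseteq> {b}"
        using same_side less_linear by blast
      ultimately obtain a b where "{x \<in> C \<inter> S. p \<sqsubset> x} \<subseteq> {a}" "{x \<in> C \<inter> S. x \<sqsubset> p} \<subseteq> {b}"
        by blast
      then have "C \<inter> S \<subseteq> {p, a, b}"
        using less_linear by blast
      then show ?thesis
        by (rule finite_subset) simp
    qed
    then have "T derived_set_of (C \<inter> S) = {}"
      using Hausdorff derived_set_of_finite by blast
    then show False
      using openin_Int_derived_set_of_subset[OF C(1)] C(2) p by blast
  qed
  then show ?thesis
    by blast
qed

subsection \<open>Points at which a closed ray is open\<close>

text \<open>These rays are always closed, so at such a point the space splits into two clopen parts
  just to the left of \<open>x\<close>.\<close>

definition left_cuts :: "'a set"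
  where "left_cuts = {x \<in> topspace T. openin T {y \<in> topspace T. x \<sqsubseteq> y}}"

definition right_cuts :: "'a set"
  where "right_cuts = {x \<in> topspace T. openin T {y \<in> topspace T. y \<sqsubseteq> x}}"

text \<open>The closed ray is the union of \<open>U\<close> and the open ray below \<open>x\<close>.
  The contrapositive is what gets used: every neighbourhood of a point outside
  \<open>right_cuts\<close> has points to the right of it.\<close>

lemma right_isolated_in_right_cuts:
  assumes "openin T U" "x \<in> U" "\<And>y. y \<in> U \<Longrightarrow> \<not> x \<sqsubset> y"
  shows "x \<in> right_cuts"
proof -
  have x: "x \<in> topspace T"
    using assms openin_subset by blast
  have "y \<in> topspace T \<and> y \<sqsubseteq> x" if "y \<in> U" for y
    using that assms(1) openin_subset leI[OF assms(3)] by blast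
  then have "{y \<in> topspace T. y \<sqsubseteq> x} = U \<union> {y \<in> topspace T. y \<sqsubset> x}"
    using assms(2) le_less by auto
  then show ?thesis
    using assms openin_below[OF x] x by (simp add: right_cuts_def openin_Un)
qed

definition split_cover :: "'a \<Rightarrow> 'a set set"
  where "split_cover x = {{y \<in> topspace T. y \<sqsubset> x}, {y \<in> topspace T. x \<sqsubseteq> y}}"

lemma open_cover_split_cover: "x \<in> left_cuts \<Longrightarrow> open_cover T (split_cover x)"
  using openin_below by (auto simp: open_cover_def split_cover_def left_cuts_def)

text \<open>Closure preservation can only place \<open>x\<close> in the closure of \<open>H\<close>,
  not in \<open>H\<close> itself. The set \<open>D\<close> will be one closed discrete layer of the
  dense set.\<close>

definition reaching :: "('a set set \<Rightarrow> 'a set set) \<Rightarrow> 'a set \<Rightarrow> 'a set" where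
  "reaching r D = {x \<in> left_cuts.
     \<exists>H\<in>r (split_cover x). x \<in> T closure_of H \<and> (\<exists>d\<in>H \<inter> D. x \<sqsubset> d)}"

text \<open>
  If \<open>p\<close> were a limit from the right of points \<open>y\<close> of \<open>reaching r D\<close>, the cover \<open>\<W>\<close> of the proof
  would be refined by all the covers \<open>split_cover y\<close>, so \<open>r \<W>\<close> would have a member close to each
  \<open>y\<close> and, because it contains a point of \<open>D\<close> beyond \<open>y\<^sub>0\<close>, bounded away from \<open>p\<close>.
\<close>
lemma reaching_not_limit_from_right:
  assumes r: "monotone_closure_preserving_operator T r"
    and D: "T derived_set_of D = {}" "D \<subseteq> topspace T"
    and p: "p \<in> topspace T"
  shows "\<exists>U. openin T U \<and> p \<in> U \<and> (\<forall>y\<in>U \<inter> reaching r D. \<not> p \<sqsubset> y)"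
proof (rule ccontr)
  assume neg: "\<not> ?thesis"
  then have lim: "\<exists>y\<in>U \<inter> reaching r D. p \<sqsubset> y" if "openin T U" "p \<in> U" for U
    using that by blast
  obtain C where C: "openin T C" "p \<in> C" "\<And>d. \<lbrakk>d \<in> C; d \<in> D\<rbrakk> \<Longrightarrow> d = p" "ord_convex C"
    using convex_nhd_avoiding[OF openin_topspace p D(1)] by metis
  obtain y\<^sub>0 where y0: "y\<^sub>0 \<in> C" "y\<^sub>0 \<in> reaching r D" "p \<sqsubset> y\<^sub>0"
    using lim[OF C(1,2)] by blast
  \<comment> \<open>The bound \<open>y \<sqsubseteq> y\<^sub>0\<close> puts the lower half of each
    \<open>split_cover y\<close> inside the one lower ray of \<open>\<W>\<close>, so that all these
    covers refine \<open>\<W>\<close>.\<close>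
  define S where "S = {y \<in> reaching r D. p \<sqsubset> y \<and> y \<sqsubseteq> y\<^sub>0}"
  define \<W> where "\<W> = insert {z \<in> topspace T. z \<sqsubset> y\<^sub>0} ((\<lambda>y. {z \<in> topspace T. y \<sqsubseteq> z}) ` S)"
  have S_cut: "y \<in> left_cuts" if "y \<in> S" for y
    using that by (auto simp: S_def reaching_def)
  have left_cuts_sub: "left_cuts \<subseteq> topspace T"
    by (auto simp: left_cuts_def)
  have "y\<^sub>0 \<in> S"
    using y0 by (simp add: S_def)
  have y0_X: "y\<^sub>0 \<in> topspace T"
    using S_cut[OF \<open>y\<^sub>0 \<in> S\<close>] left_cuts_sub by blast
  have cover: "open_cover T \<W>"
  proof -
    have "openin T W" if "W \<in> \<W>" for W
      using that openin_below[OF y0_X] S_cut by (auto simp: \<W>_def left_cuts_def)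
    moreover have "\<Union>\<W> \<subseteq> topspace T"
      by (auto simp: \<W>_def)
    moreover have "z \<in> \<Union>\<W>" if "z \<in> topspace T" for z
    proof (cases "z \<sqsubset> y\<^sub>0")
      case False
      then have "y\<^sub>0 \<sqsubseteq> z"
        by (rule leI)
      with that \<open>y\<^sub>0 \<in> S\<close> show ?thesis
        by (auto simp: \<W>_def)
    qed (use that in \<open>auto simp: \<W>_def\<close>)
    ultimately show ?thesis
      by (simp add: open_cover_def subset_antisym subsetI)
  qed
  have split_refines: "refines (split_cover y) \<W>" if "y \<in> S" for y
  proof -
    have "{z \<in> topspace T. z \<sqsubset> y} \<subseteq> {z \<in> topspace T. z \<sqsubset> y\<^sub>0}"
      using that by (auto simp: S_def intro: less_le_trans)
    then show ?thesis
      using that unfolding refines_def split_cover_def \<W>_def by simp blast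
  qed
  have cp: "closure_preserving T (r \<W>)" "refines (r \<W>) \<W>"
    using r cover by (auto simp: monotone_closure_preserving_operator_def)
  \<comment> \<open>These members of \<open>r \<W>\<close> stay away from \<open>p\<close>: each
    lies in a closed ray that starts beyond \<open>p\<close>.\<close>
  define \<F> where "\<F> = {A \<in> r \<W>. \<exists>y\<in>S. A \<subseteq> {z \<in> topspace T. y \<sqsubseteq> z}}"
  have near: "y \<in> T closure_of \<Union>\<F>" if y: "y \<in> S" for y
  proof -
    obtain H d where H: "H \<in> r (split_cover y)" "y \<in> T closure_of H" "d \<in> H" "d \<in> D" "y \<sqsubset> d"
      using y by (auto simp: S_def reaching_def)
    have "refines (r (split_cover y)) (r \<W>)"
      using r cover open_cover_split_cover[OF S_cut[OF y]] split_refines[OF y]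
      unfolding monotone_closure_preserving_operator_def by blast
    then obtain A where A: "A \<in> r \<W>" "H \<subseteq> A"
      using H unfolding refines_def by blast
    \<comment> \<open>The only point of \<open>D\<close> that \<open>C\<close> can contain is
      \<open>p\<close>, so \<open>d\<close> is outside \<open>C\<close> and, by convexity, not below
      \<open>y\<^sub>0\<close>. Hence \<open>A\<close> does not fit into the lower ray of
      \<open>\<W>\<close> and must lie in an upper one.\<close>
    have "p \<sqsubset> d"
      using y H(5) by (auto simp: S_def)
    then have "d \<notin> C"
      using C(3) H(4) by blast
    then have "\<not> d \<sqsubset> y\<^sub>0"
      using ord_convexD[OF C(4,2) y0(1), of d] D(2) H(4) \<open>p \<sqsubset> d\<close>
        by (auto dest: less_imp_le)
    then have "\<not> A \<subseteq> {z \<in> topspace T. z \<sqsubset> y\<^sub>0}"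
      using A(2) H(3) by blast
    moreover obtain W where "W \<in> \<W>" "A \<subseteq> W"
      using A(1) cp(2) unfolding refines_def by blast
    ultimately have "A \<in> \<F>"
      using A(1) by (auto simp: \<W>_def \<F>_def)
    then have "T closure_of H \<subseteq> T closure_of \<Union>\<F>"
      using A(2) by (intro closure_of_mono) blast
    then show ?thesis
      using H(2) by blast
  qed
  have "p \<in> T closure_of \<Union>\<F>"
    unfolding in_closure_of
  proof (intro conjI allI impI p)
    fix U
    assume U: "p \<in> U \<and> openin T U"
    \<comment> \<open>Intersecting with the ray below \<open>y\<^sub>0\<close> forces the point
      obtained from \<open>lim\<close> into \<open>S\<close>.\<close>
    have "openin T (U \<inter> {z \<in> topspace T. z \<sqsubset> y\<^sub>0})" "p \<in> U \<inter> {z \<in> topspace T. z \<sqsubset> y\<^sub>0}"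
      using U p y0(3) openin_below[OF y0_X] by (auto intro: openin_Int)
    from lim[OF this] obtain y where "y \<in> U" "y \<in> S"
      by (auto simp: S_def)
    with near U show "\<exists>z. z \<in> \<Union>\<F> \<and> z \<in> U"
      unfolding in_closure_of by blast
  qed
  moreover have "T closure_of \<Union>\<F> = (\<Union>A\<in>\<F>. T closure_of A)"
    by (rule closure_preservingD[OF cp(1)]) (auto simp: \<F>_def)
  ultimately obtain A y where A: "p \<in> T closure_of A" "y \<in> S" "A \<subseteq> {z \<in> topspace T. y \<sqsubseteq> z}"
    unfolding \<F>_def by blast
  \<comment> \<open>Closure preservation has put \<open>p\<close> into the closure of a single
    member, hence into a closed ray starting at \<open>y\<close>, although
    \<open>p \<sqsubset> y\<close>.\<close>
  have "closedin T {z \<in> topspace T. y \<sqsubseteq> z}"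
    using closedin_at_least S_cut[OF A(2)] left_cuts_sub by blast
  then have "y \<sqsubseteq> p"
    using A closure_of_minimal by blast
  then show False
    using A(2) by (auto simp: S_def)
qed

text \<open>A left cut is either isolated, and then in the dense set, or lies in one of the
  countably many sets \<open>layer A B\<close>.\<close>

lemma left_cuts_covered:
  assumes r: "monotone_closure_preserving_operator T r"
    and \<D>: "countable \<D>" "\<And>D. D \<in> \<D> \<Longrightarrow> D \<subseteq> topspace T \<and> T derived_set_of D = {}"
    and dense: "T closure_of \<Union>\<D> = topspace T"
  shows "\<exists>\<S>. countable \<S> \<and> (\<forall>S\<in>\<S>. S \<subseteq> topspace T \<and> T derived_set_of S = {}) \<and> left_cuts \<subseteq> \<Union>\<S>"
proof -
  have meets: "\<exists>D\<in>\<D>. \<exists>d\<in>D. d \<in> U" if "openin T U" "x \<in> U" for U x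
  proof -
    have "x \<in> T closure_of \<Union>\<D>"
      using that dense openin_subset by blast
    then show ?thesis
      using that unfolding in_closure_of by blast
  qed
  \<comment> \<open>A point of \<open>B\<close> lies between \<open>x\<close> and all later points
    of \<open>reaching r A\<close>. So \<open>B\<close> separates the points of
    \<open>layer A B\<close> from each other, and they do not accumulate.\<close>
  define layer where "layer A B = {x \<in> reaching r A. \<exists>d\<in>B. x \<sqsubset> d \<and> (\<forall>y\<in>reaching r A. x \<sqsubset> y \<longrightarrow> d \<sqsubset> y)}"
    for A B
  have layer: "layer A B \<subseteq> topspace T \<and> T derived_set_of (layer A B) = {}" if "A \<in> \<D>" "B \<in> \<D>" for A B
  proof
    show "layer A B \<subseteq> topspace T"
      by (auto simp: layer_def reaching_def left_cuts_def)
    show "T derived_set_of (layer A B) = {}"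
    proof (rule derived_set_of_eq_empty_if_separated)
      show "T derived_set_of B = {}" "B \<subseteq> topspace T"
        using \<D>(2)[OF \<open>B \<in> \<D>\<close>] by auto
      show "\<exists>d\<in>B. x \<sqsubset> d \<and> d \<sqsubset> y" if "x \<in> layer A B" "y \<in> layer A B" "x \<sqsubset> y" for x y
        using that unfolding layer_def by blast
    qed
  qed
  have covered: "x \<in> \<Union>\<D> \<or> (\<exists>A\<in>\<D>. \<exists>B\<in>\<D>. x \<in> layer A B)" if x: "x \<in> left_cuts" for x
  proof (cases "x \<in> right_cuts")
    case True
    \<comment> \<open>Being a cut on both sides, \<open>x\<close> is isolated, and a dense set
      contains every isolated point.\<close>
    have "openin T ({y \<in> topspace T. x \<sqsubseteq> y} \<inter> {y \<in> topspace T. y \<sqsubseteq> x})"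
      using True x by (auto simp: left_cuts_def right_cuts_def)
    moreover have "{y \<in> topspace T. x \<sqsubseteq> y} \<inter> {y \<in> topspace T. y \<sqsubseteq> x} = {x}"
      using x by (auto simp: left_cuts_def)
    ultimately show ?thesis
      using meets[of "{x}" x] by auto
  next
    case False
    then have beyond: "\<exists>D\<in>\<D>. \<exists>d\<in>D. d \<in> U \<and> x \<sqsubset> d" if U: "openin T U" "x \<in> U" for U
    proof -
      obtain y where "y \<in> U" "x \<sqsubset> y"
        using right_isolated_in_right_cuts[OF U] False by blast
      moreover have "x \<in> topspace T"
        using x by (simp add: left_cuts_def)
      ultimately have "openin T (U \<inter> {y \<in> topspace T. x \<sqsubset> y})" "y \<in> U \<inter> {y \<in> topspace T. x \<sqsubset> y}"
        using U openin_above openin_subset by blast+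
      from meets[OF this] show ?thesis
        by blast
    qed
    have X: "x \<in> topspace T"
      using x by (simp add: left_cuts_def)
    let ?\<U> = "split_cover x"
    \<comment> \<open>By closure preservation some neighbourhood of \<open>x\<close> misses all
      members whose closure omits \<open>x\<close>. Any member meeting that neighbourhood therefore
      has \<open>x\<close> in its closure.\<close>
    let ?\<H> = "{H \<in> r ?\<U>. x \<notin> T closure_of H}"
    have cp: "closure_preserving T (r ?\<U>)" "\<Union>(r ?\<U>) = topspace T"
      using r open_cover_split_cover[OF x] by (auto simp: monotone_closure_preserving_operator_def)
    have "T closure_of \<Union>?\<H> = (\<Union>H\<in>?\<H>. T closure_of H)"
      by (rule closure_preservingD[OF cp(1)]) auto
    then have "x \<notin> T closure_of \<Union>?\<H>"
      by blast
    then obtain U where U: "openin T U" "x \<in> U" "\<And>y. y \<in> U \<Longrightarrow> y \<notin> \<Union>?\<H>"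
      using X unfolding in_closure_of by blast
    obtain A d where A: "A \<in> \<D>" "d \<in> A" "d \<in> U" "x \<sqsubset> d"
      using beyond[OF U(1,2)] by blast
    obtain H where "H \<in> r ?\<U>" "d \<in> H"
      using cp(2) A U(1) openin_subset by blast
    then have "x \<in> reaching r A"
      using U(3) A x by (auto simp: reaching_def)
    obtain V where V: "openin T V" "x \<in> V" "\<And>y. y \<in> V \<inter> reaching r A \<Longrightarrow> \<not> x \<sqsubset> y"
      using reaching_not_limit_from_right[OF r _ _ X, of A] \<D>(2)[OF A(1)] by blast
    obtain C where C: "openin T C" "x \<in> C" "C \<subseteq> V" "ord_convex C"
      using convex_nhd[OF V(1,2)] by blast
    \<comment> \<open>\<open>C\<close> has no point of \<open>reaching r A\<close> to the right of
      \<open>x\<close>, so by convexity \<open>e\<close> precedes all such points.\<close>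
    obtain B e where B: "B \<in> \<D>" "e \<in> B" "e \<in> C" "x \<sqsubset> e"
      using beyond[OF C(1,2)] by blast
    have "e \<sqsubset> y" if y: "y \<in> reaching r A" "x \<sqsubset> y" for y
    proof (rule ccontr)
      assume "\<not> e \<sqsubset> y"
      moreover have "y \<in> topspace T"
        using y by (simp add: reaching_def left_cuts_def)
      ultimately have "y \<in> C"
        using ord_convexD[OF C(4,2) B(3)] y by auto
      then show False
        using V(3) C(3) y by blast
    qed
    then have "x \<in> layer A B"
      using B \<open>x \<in> reaching r A\<close> by (auto simp: layer_def)
    then show ?thesis
      using A B by blast
  qed
  let ?\<S> = "\<D> \<union> (\<lambda>(A, B). layer A B) ` (\<D> \<times> \<D>)"
  have "countable ?\<S>"
    using \<D>(1) by simp
  moreover have "\<forall>S\<in>?\<S>. S \<subseteq> topspace T \<and> T derived_set_of S = {}"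
    using layer \<D>(2) by (simp add: ball_Un)
  moreover have "left_cuts \<subseteq> \<Union>?\<S>"
    using covered by fastforce
  ultimately show ?thesis
    by blast
qed

subsection \<open>Normality\<close>

text \<open>
  Disjoint closed sets \<open>A\<close> and \<open>B\<close> are separated by choosing a point \<open>c x\<close> in every convex component
  of the complement of \<open>A \<union> B\<close>; it decides where a component with one end in \<open>A\<close> and the other in
  \<open>B\<close> is cut.
\<close>

definition reached_below :: "'a set \<Rightarrow> 'a set \<Rightarrow> 'a \<Rightarrow> bool"
  where "reached_below A B x \<longleftrightarrow> (\<exists>a\<in>A. a \<sqsubseteq> x \<and> (\<forall>z\<in>B. \<not> (a \<sqsubseteq> z \<and> z \<sqsubseteq> x)))"

definition reached_above :: "'a set \<Rightarrow> 'a set \<Rightarrow> 'a \<Rightarrow> bool"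
  where "reached_above A B x \<longleftrightarrow> (\<exists>a\<in>A. x \<sqsubseteq> a \<and> (\<forall>z\<in>B. \<not> (x \<sqsubseteq> z \<and> z \<sqsubseteq> a)))"

text \<open>Of a witness in \<open>A\<close> and a witness in \<open>B\<close>, both at or below
  \<open>x\<close>, the larger lies between the smaller and \<open>x\<close>. Witnesses are used
  because a nearest point of \<open>A\<close> need not exist.\<close>

lemma reached_below_disjoint: "reached_below A B x \<Longrightarrow> \<not> reached_below B A x"
  unfolding reached_below_def by (meson linear)

lemma reached_above_disjoint: "reached_above A B x \<Longrightarrow> \<not> reached_above B A x"
  unfolding reached_above_def by (meson linear)

text \<open>Take a convex neighbourhood \<open>C\<close> of \<open>a\<close> that misses
  \<open>B\<close>. If \<open>C\<close> has a further point of \<open>A\<close> to the right, the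
  points before it are reached from both sides; if \<open>C\<close> has no point to the right,
  nothing is to be shown. Otherwise the points of \<open>C\<close> between \<open>a\<close> and
  \<open>w\<close> lie in one component, where \<open>c\<close> is constant with a value beyond
  \<open>a\<close>, and it suffices to stop before that value.\<close>

lemma right_nhd_of_reached:
  assumes A: "A \<subseteq> topspace T" and B: "closedin T B" and a: "a \<in> A" "a \<notin> B"
    and c: "\<And>w. w \<in> topspace T \<Longrightarrow> c w \<in> topspace T"
      "\<And>w. \<lbrakk>w \<in> topspace T; a \<sqsubset> w\<rbrakk> \<Longrightarrow> a \<sqsubset> c w"
      "\<And>x w. \<lbrakk>x \<in> topspace T; w \<in> topspace T; x \<sqsubset> w; \<forall>z\<in>A \<union> B. \<not> (x \<sqsubseteq> z \<and> z \<sqsubseteq> w)\<rbrakk> \<Longrightarrow> c x = c w"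
  shows "\<exists>V. openin T V \<and> a \<in> V \<and>
    (\<forall>x\<in>V. a \<sqsubset> x \<longrightarrow> reached_below A B x \<and> (reached_above A B x \<or> x \<sqsubset> c x))"
proof -
  have "openin T (topspace T - B)" "a \<in> topspace T - B"
    using A B a by auto
  then obtain C where C: "openin T C" "a \<in> C" "C \<subseteq> topspace T - B" "ord_convex C"
    using convex_nhd by metis
  have BX: "B \<subseteq> topspace T"
    using B closedin_subset by blast
  have noB: "\<not> (u \<sqsubseteq> z \<and> z \<sqsubseteq> v)" if "u \<in> C" "v \<in> C" "z \<in> B" for u v z
    using ord_convexD[OF C(4), of u v z] that C(3) BX by blast
  have below: "reached_below A B x" if "x \<in> C" "a \<sqsubset> x" for x
    unfolding reached_below_def using that a(1) C(2) noB less_imp_le by blast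
  consider a' where "a' \<in> C" "a' \<in> A" "a \<sqsubset> a'" | "\<And>w. w \<in> C \<Longrightarrow> \<not> a \<sqsubset> w"
    | w where "w \<in> C" "a \<sqsubset> w" "\<And>a'. a' \<in> C \<Longrightarrow> a' \<in> A \<Longrightarrow> \<not> a \<sqsubset> a'"
    by blast
  then show ?thesis
  proof cases
    case 1
    let ?V = "C \<inter> {y \<in> topspace T. y \<sqsubset> a'}"
    have "openin T ?V" "a \<in> ?V"
      using C openin_below 1 A a by (auto intro!: openin_Int)
    moreover have "reached_above A B x" if "x \<in> ?V" for x
      unfolding reached_above_def using that 1 noB less_imp_le by blast
    ultimately show ?thesis
      using below by (intro exI[of _ ?V]) blast
  next
    case 2
    then show ?thesis
      using C by blast
  next
    case 3
    have w: "w \<in> topspace T"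
      using 3(1) C(3) by blast
    let ?V = "C \<inter> ({y \<in> topspace T. y \<sqsubset> w} \<inter> {y \<in> topspace T. y \<sqsubset> c w})"
    have "openin T ?V" "a \<in> ?V"
      using C openin_below[OF w] openin_below[OF c(1)[OF w]] c(2)[OF w] 3 A a
      by (auto intro!: openin_Int)
    moreover have "x \<sqsubset> c x" if x: "x \<in> ?V" "a \<sqsubset> x" for x
    proof -
      have "\<not> (x \<sqsubseteq> z \<and> z \<sqsubseteq> w)" if "z \<in> A \<union> B" for z
      proof
        assume z: "x \<sqsubseteq> z \<and> z \<sqsubseteq> w"
        then have "z \<in> C"
          using ord_convexD[OF C(4), of x w z] x 3(1) that A BX by blast
        moreover have "a \<sqsubset> z"
          using z x(2) less_le_trans by blast
        ultimately show False
          using that 3(3) C(3) by blast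
      qed
      then have "c x = c w"
        using c(3)[OF _ w] x by blast
      then show ?thesis
        using x by simp
    qed
    ultimately show ?thesis
      using below by (intro exI[of _ ?V]) blast
  qed
qed

text \<open>A label for the convex components of the complement of \<open>Z\<close>: points outside
  \<open>Z\<close> share it exactly when no point of \<open>Z\<close> lies between them. Keeping
  both halves gives each point of \<open>Z\<close> a label of its own.\<close>

definition position :: "'a set \<Rightarrow> 'a \<Rightarrow> 'a set \<times> 'a set"
  where "position Z x = ({z \<in> Z. z \<sqsubset> x}, {z \<in> Z. x \<sqsubset> z})"

lemma position_eqD:
  assumes "position Z x = position Z y" "z \<in> Z"
  shows "z \<sqsubset> x \<longleftrightarrow> z \<sqsubset> y" "x \<sqsubset> z \<longleftrightarrow> y \<sqsubset> z"
  using assms by (auto simp: position_def set_eq_iff)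

lemma position_eqI:
  assumes "x \<sqsubset> w" "\<And>z. z \<in> Z \<Longrightarrow> \<not> (x \<sqsubseteq> z \<and> z \<sqsubseteq> w)"
  shows "position Z x = position Z w"
proof -
  have "(z \<sqsubset> x \<longleftrightarrow> z \<sqsubset> w) \<and> (x \<sqsubset> z \<longleftrightarrow> w \<sqsubset> z)" if "z \<in> Z" for z
    using assms(1) assms(2)[OF that] by (meson leI less_imp_le less_trans not_less)
  then show ?thesis
    by (auto simp: position_def)
qed

text \<open>The interiors of \<open>G A B\<close> and \<open>G B A\<close> separate \<open>A\<close>
  from \<open>B\<close>. Near a point of \<open>S\<close> the set \<open>G S S'\<close> contains a
  right part by \<open>right_nhd_of_reached\<close> and a left part by the same lemma for the
  reversed order.\<close>

theorem normal: "normal_space T"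
  unfolding normal_space_def
proof (intro allI impI)
  fix A B
  assume AB: "closedin T A \<and> closedin T B \<and> disjnt A B"
  interpret dual: go_order "\<lambda>x y. y \<sqsubseteq> x" "\<lambda>x y. y \<sqsubset> x" T
    by (rule dual_go_order)
  have dual_reached: "dual.reached_below = reached_above" "dual.reached_above = reached_below"
    by (auto simp: fun_eq_iff dual.reached_below_def dual.reached_above_def
        reached_below_def reached_above_def)
  \<comment> \<open>The choice depends on \<open>x\<close> only through its position, so
    \<open>c\<close> has one value on each component.\<close>
  define c where "c x = (SOME y. y \<in> topspace T \<and> position (A \<union> B) y = position (A \<union> B) x)" for x
  have c: "c x \<in> topspace T" "position (A \<union> B) (c x) = position (A \<union> B) x" if "x \<in> topspace T" for x
    using that someI[of "\<lambda>y. y \<in> topspace T \<and> position (A \<union> B) y = position (A \<union> B) x" x]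
    unfolding c_def by auto
  have c_eq: "c x = c w" if "position (A \<union> B) x = position (A \<union> B) w" for x w
    using that by (simp add: c_def)
  \<comment> \<open>A point is allotted to \<open>S\<close> if \<open>S\<close> is reached on both
    sides, or if it is reached on one side and the point lies strictly on that side of
    \<open>c x\<close>.\<close>
  define G where "G S S' = {x \<in> topspace T. reached_below S S' x \<and> reached_above S S' x \<or>
      reached_below S S' x \<and> x \<sqsubset> c x \<or> reached_above S S' x \<and> c x \<sqsubset> x}" for S S'
  have sub: "S \<subseteq> T interior_of G S S'"
    if S: "closedin T S" "closedin T S'" "S \<inter> S' = {}" "S \<union> S' = A \<union> B" for S S'
  proof
    fix a
    assume a: "a \<in> S"
    have SX: "S \<subseteq> topspace T"
      using S closedin_subset by blast
    have aS': "a \<notin> S'"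
      using a S by blast
    have aAB: "a \<in> A \<union> B"
      using a S(4) by blast
    have side: "a \<sqsubset> c w \<longleftrightarrow> a \<sqsubset> w" "c w \<sqsubset> a \<longleftrightarrow> w \<sqsubset> a" if "w \<in> topspace T" for w
      using position_eqD[OF c(2)[OF that] aAB] by auto
    have const: "c x = c w" if "x \<sqsubset> w" "\<forall>z\<in>S \<union> S'. \<not> (x \<sqsubseteq> z \<and> z \<sqsubseteq> w)" for x w
      using that by (intro c_eq position_eqI) (auto simp: S(4))
    obtain V where V: "openin T V" "a \<in> V"
      "\<forall>x\<in>V. a \<sqsubset> x \<longrightarrow> reached_below S S' x \<and> (reached_above S S' x \<or> x \<sqsubset> c x)"
      using right_nhd_of_reached[OF SX S(2) a aS', of c] c(1) side(1) const by blast
    have const': "c x = c w" if "w \<sqsubset> x" "\<forall>z\<in>S \<union> S'. \<not> (z \<sqsubseteq> x \<and> w \<sqsubseteq> z)" for x w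
      using const[of w x] that by metis
    obtain W where W: "openin T W" "a \<in> W"
      "\<forall>x\<in>W. x \<sqsubset> a \<longrightarrow> reached_above S S' x \<and> (reached_below S S' x \<or> c x \<sqsubset> x)"
      using dual.right_nhd_of_reached[OF SX S(2) a aS', of c] c(1) side(2) const'
      unfolding dual_reached by blast
    have "x \<in> G S S'" if "x \<in> V \<inter> W" for x
    proof -
      have "x \<in> topspace T"
        using that V(1) openin_subset by blast
      moreover have "reached_below S S' a" "reached_above S S' a"
        using a aS' order.antisym unfolding reached_below_def reached_above_def by blast+
      ultimately show ?thesis
        using V(3) W(3) that less_linear[of x a] by (auto simp: G_def)
    qed
    then show "a \<in> T interior_of G S S'"
      using V W openin_Int[OF V(1) W(1)] by (auto simp: interior_of_def)
  qed
  have "A \<inter> B = {}"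
    using AB by (simp add: disjnt_def)
  then have "A \<subseteq> T interior_of G A B" "B \<subseteq> T interior_of G B A"
    using AB sub[of A B] sub[of B A] by (simp_all add: Int_commute Un_commute)
  moreover have "disjnt (G A B) (G B A)"
    unfolding disjnt_iff
  proof
    fix x
    show "\<not> (x \<in> G A B \<and> x \<in> G B A)"
      using reached_below_disjoint[of A B x] reached_above_disjoint[of A B x]
        less_asym[of x "c x"]
      unfolding G_def by blast
  qed
  then have "disjnt (T interior_of G A B) (T interior_of G B A)"
    by (meson disjnt_subset1 disjnt_subset2 interior_of_subset)
  ultimately show "\<exists>U V. openin T U \<and> openin T V \<and> A \<subseteq> U \<and> B \<subseteq> V \<and> disjnt U V"
    by (intro exI[of _ "T interior_of G A B"] exI[of _ "T interior_of G B A"]) auto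
qed

subsection \<open>Metrizability\<close>

text \<open>
  For closed discrete \<open>Z\<close> and \<open>Y\<close> this set is closed; as \<open>Y\<close> runs through the unions of two layers
  of the dense set, these sets exhaust the complement of \<open>Z\<close>.
\<close>
definition screened :: "'a set \<Rightarrow> 'a set \<Rightarrow> 'a set" where
  "screened Z Y = {x \<in> topspace T - Z. \<forall>z\<in>Z.
     (x \<sqsubset> z \<longrightarrow> (\<exists>d\<in>Y. x \<sqsubseteq> d \<and> d \<sqsubset> z)) \<and> (z \<sqsubset> x \<longrightarrow> (\<exists>d\<in>Y. z \<sqsubset> d \<and> d \<sqsubseteq> x))}"

text \<open>Let \<open>C\<close> be a convex neighbourhood of \<open>p\<close> whose only possible
  point of \<open>Y\<close> is \<open>p\<close>. If \<open>p\<close> fails the condition because of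
  some \<open>z\<close>, then for \<open>x\<close> in \<open>C\<close> on the same side of
  \<open>z\<close> a point of \<open>Y\<close> between \<open>x\<close> and \<open>z\<close> would
  have to lie between \<open>x\<close> and \<open>p\<close> and differ from \<open>p\<close>, which
  \<open>C\<close> excludes. If \<open>p\<close> is in \<open>Z\<close>, the same holds with
  \<open>z = p\<close> for \<open>x\<close> different from \<open>p\<close>.\<close>

lemma closedin_screened:
  assumes Y: "Y \<subseteq> topspace T" "T derived_set_of Y = {}"
    and Z: "Z \<subseteq> topspace T"
  shows "closedin T (screened Z Y)"
  unfolding closedin_def
proof
  show "screened Z Y \<subseteq> topspace T"
    by (auto simp: screened_def)
  show "openin T (topspace T - screened Z Y)"
  proof (subst openin_subopen, intro ballI)
    fix p
    assume p: "p \<in> topspace T - screened Z Y"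
    then obtain C where C: "openin T C" "p \<in> C" "\<And>d. \<lbrakk>d \<in> C; d \<in> Y\<rbrakk> \<Longrightarrow> d = p" "ord_convex C"
      using convex_nhd_avoiding[OF openin_topspace _ Y(2)] by (metis DiffD1)
    have between: "d = p" if "d \<in> Y" "x \<in> C" "x \<sqsubseteq> d \<and> d \<sqsubseteq> p \<or> p \<sqsubseteq> d \<and> d \<sqsubseteq> x" for d x
      using that C(2,3) ord_convexD[OF C(4), of x p d] ord_convexD[OF C(4), of p x d] Y(1) by blast
    consider "p \<in> Z"
      | z where "z \<in> Z" "p \<sqsubset> z" "\<And>d. d \<in> Y \<Longrightarrow> \<not> (p \<sqsubseteq> d \<and> d \<sqsubset> z)"
      | z where "z \<in> Z" "z \<sqsubset> p" "\<And>d. d \<in> Y \<Longrightarrow> \<not> (z \<sqsubset> d \<and> d \<sqsubseteq> p)"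
      using p unfolding screened_def by blast
    then obtain V where "openin T V" "p \<in> V" "\<And>x. x \<in> V \<Longrightarrow> x \<notin> screened Z Y"
    proof cases
      case 1
      have "x \<notin> screened Z Y" if x: "x \<in> C" for x
      proof
        assume s: "x \<in> screened Z Y"
        then have "x \<noteq> p"
          using 1 by (auto simp: screened_def)
        then consider "x \<sqsubset> p" | "p \<sqsubset> x"
          using less_linear by blast
        then obtain d where "d \<in> Y" "x \<sqsubseteq> d \<and> d \<sqsubset> p \<or> p \<sqsubset> d \<and> d \<sqsubseteq> x"
          using s 1 unfolding screened_def by cases blast+
        then show False
          using between[OF _ x, of d] less_imp_le by blast
      qed
      with C that show thesis
        by blast
    next
      case 2
      let ?V = "C \<inter> {y \<in> topspace T. y \<sqsubset> z}"
      have "x \<notin> screened Z Y" if x: "x \<in> ?V" for x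
      proof
        assume "x \<in> screened Z Y"
        then obtain d where d: "d \<in> Y" "x \<sqsubseteq> d" "d \<sqsubset> z"
          using 2(1) x unfolding screened_def by blast
        then have "d \<sqsubset> p"
          using 2(3) leI by blast
        then show False
          using between[of d x] d x less_imp_le by blast
      qed
      moreover have "openin T ?V" "p \<in> ?V"
        using C openin_below[of z] 2 p Z by (auto intro: openin_Int)
      ultimately show thesis
        using that by blast
    next
      case 3
      let ?V = "C \<inter> {y \<in> topspace T. z \<sqsubset> y}"
      have "x \<notin> screened Z Y" if x: "x \<in> ?V" for x
      proof
        assume "x \<in> screened Z Y"
        then obtain d where d: "d \<in> Y" "z \<sqsubset> d" "d \<sqsubseteq> x"
          using 3(1) x unfolding screened_def by blast
        then have "p \<sqsubset> d"
          using 3(3) leI by blast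
        then show False
          using between[of d x] d x less_imp_le by blast
      qed
      moreover have "openin T ?V" "p \<in> ?V"
        using C openin_above[of z] 3 p Z by (auto intro: openin_Int)
      ultimately show thesis
        using that by blast
    qed
    then show "\<exists>V. openin T V \<and> p \<in> V \<and> V \<subseteq> topspace T - screened Z Y"
      using openin_subset by (intro exI[of _ V]) blast
  qed
qed

text \<open>Urysohn's lemma applies to \<open>Z\<close> and the closed set of screened points. The
  height \<open>1/2\<close> on the latter ensures that a point at hedgehog distance below
  \<open>1/2\<close> from a screened point is on the same spine.\<close>

lemma screening_function:
  assumes Y: "Y \<subseteq> topspace T" "T derived_set_of Y = {}"
    and Z: "Z \<subseteq> topspace T" "T derived_set_of Z = {}"
  shows "\<exists>f. continuous_map T euclideanreal f \<and> (\<forall>x. 0 \<le> f x \<and> f x \<le> 1/2) \<and>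
    (\<forall>x\<in>Z. f x = 0) \<and> (\<forall>x\<in>screened Z Y. f x = 1/2)"
proof -
  have "closedin T Z"
    using Z derived_set_subset by blast
  moreover have "disjnt Z (screened Z Y)"
    by (auto simp: disjnt_iff screened_def)
  ultimately obtain f where f: "continuous_map T (top_of_set {0..1/2}) f"
    "f ` Z \<subseteq> {0}" "f ` screened Z Y \<subseteq> {1/2::real}"
    using Urysohn_lemma[OF normal _ closedin_screened[OF Y Z(1)], of Z 0 "1/2"] by auto
  \<comment> \<open>The bounds on \<open>f\<close> hold only on \<open>topspace T\<close>; the value
    \<open>0\<close> elsewhere extends them to the whole type, where the pseudometric axioms are
    required.\<close>
  define g where "g x = (if x \<in> topspace T then f x else 0)" for x
  have "continuous_map T euclideanreal g"
    using f(1) unfolding continuous_map_in_subtopology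
    by (auto simp: g_def intro: continuous_map_eq)
  moreover have "0 \<le> g x \<and> g x \<le> 1/2" for x
    using f(1) unfolding continuous_map_in_subtopology by (fastforce simp: g_def)
  moreover have "\<forall>x\<in>Z. g x = 0" "\<forall>x\<in>screened Z Y. g x = 1/2"
    using f(2,3) Z(1) by (auto simp: g_def screened_def)
  ultimately show ?thesis
    by blast
qed

section \<open>Local constancy of the hedgehog labels\<close>

lemma position_locally_constant:
  assumes "Z \<subseteq> topspace T" "T derived_set_of Z = {}" "x \<in> topspace T" "x \<notin> Z"
  shows "\<exists>U. openin T U \<and> x \<in> U \<and> (\<forall>y\<in>U. position Z y = position Z x)"
proof -
  obtain C where C: "openin T C" "x \<in> C" "\<And>d. \<lbrakk>d \<in> C; d \<in> Z\<rbrakk> \<Longrightarrow> d = x" "ord_convex C"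
    using convex_nhd_avoiding[OF openin_topspace assms(3,2)] by metis
  have "position Z y = position Z x" if y: "y \<in> C" for y
  proof -
    have no: "\<not> (u \<sqsubseteq> z \<and> z \<sqsubseteq> v)" if "u \<in> C" "v \<in> C" "z \<in> Z" for u v z
      using ord_convexD[OF C(4), of u v z] C(3) that assms by blast
    consider "x \<sqsubset> y" | "x = y" | "y \<sqsubset> x"
      using less_linear by blast
    then show ?thesis
    proof cases
      case 1
      then have "position Z x = position Z y"
        by (rule position_eqI) (rule no[OF C(2) y])
      then show ?thesis ..
    next
      case 3
      then show ?thesis
        by (rule position_eqI) (rule no[OF y C(2)])
    qed simp
  qed
  with C show ?thesis
    by blast
qed

text \<open>Away from \<open>A\<close> a convex neighbourhood without points of \<open>A\<close>
  works. At a point of \<open>A\<close>, intersecting with the open ray that ends there removes the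
  points above \<open>x\<close>, for which \<open>x\<close> would begin to count.\<close>

lemma cuts_below_locally_constant:
  assumes A: "A \<subseteq> right_cuts" "T derived_set_of A = {}" and x: "x \<in> topspace T"
  shows "\<exists>U. openin T U \<and> x \<in> U \<and> (\<forall>y\<in>U. {z \<in> A. z \<sqsubset> y} = {z \<in> A. z \<sqsubset> x})"
proof -
  obtain C where C: "openin T C" "x \<in> C" "\<And>d. \<lbrakk>d \<in> C; d \<in> A\<rbrakk> \<Longrightarrow> d = x" "ord_convex C"
    using convex_nhd_avoiding[OF openin_topspace x A(2)] by metis
  obtain U where U: "openin T U" "x \<in> U" "U \<subseteq> C" "\<And>y. \<lbrakk>x \<in> A; y \<in> U\<rbrakk> \<Longrightarrow> y \<sqsubseteq> x"
  proof (cases "x \<in> A")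
    case True
    then have "openin T (C \<inter> {y \<in> topspace T. y \<sqsubseteq> x})"
      using A(1) C(1) by (auto simp: right_cuts_def)
    then show thesis
      using C(2) x by (intro that[of "C \<inter> {y \<in> topspace T. y \<sqsubseteq> x}"]) auto
  qed (use C that in blast)
  have "z \<sqsubset> y \<longleftrightarrow> z \<sqsubset> x" if y: "y \<in> U" and z: "z \<in> A" for y z
  proof (rule ccontr)
    assume neq: "\<not> (z \<sqsubset> y \<longleftrightarrow> z \<sqsubset> x)"
    have "y \<in> C"
      using y U(3) by blast
    have "z \<in> topspace T"
      using A(1) z by (auto simp: right_cuts_def)
    moreover have "x \<sqsubseteq> z \<and> z \<sqsubseteq> y \<or> y \<sqsubseteq> z \<and> z \<sqsubseteq> x"
      using neq leI less_imp_le by blast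
    ultimately have "z \<in> C"
      using ord_convexD[OF C(4)] C(2) \<open>y \<in> C\<close> by blast
    then have "z = x"
      using C(3) z by blast
    then show False
      using neq U(4)[OF _ y] z by auto
  qed
  with U(1,2) show ?thesis
    by blast
qed

text \<open>To the right of \<open>x\<close>, \<open>U\<close> is controlled either by a cut at
  \<open>x\<close> or by a point \<open>d\<close> of a layer that omits \<open>x\<close>. The second
  alternative is the one in which \<open>x\<close> has positive height on a hedgehog.\<close>

lemma separation_from_right:
  fixes Z :: "nat \<Rightarrow> 'a set"
  assumes Z: "\<And>n. T derived_set_of Z n = {}" "disjoint_family Z"
    and dense: "T closure_of (\<Union>n. Z n) = topspace T"
    and cuts: "right_cuts \<subseteq> (\<Union>n. Z n)"
    and U: "openin T U" "x \<in> U"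
  shows "(\<exists>n. x \<in> Z n \<inter> right_cuts) \<or>
    (\<exists>m. x \<notin> Z m \<and> (\<exists>d\<in>Z m. x \<sqsubset> d \<and> (\<forall>y\<in>topspace T. x \<sqsubseteq> y \<and> y \<sqsubseteq> d \<longrightarrow> y \<in> U)))"
proof (cases "x \<in> right_cuts")
  case True
  then show ?thesis
    using cuts by blast
next
  case False
  have x: "x \<in> topspace T"
    using U openin_subset by blast
  \<comment> \<open>By disjointness at most one layer contains \<open>x\<close>, and
    \<open>V\<close> avoids its other points. So a dense point found in \<open>V\<close> beyond
    \<open>x\<close> belongs to a layer that omits \<open>x\<close>.\<close>
  obtain V where V: "openin T V" "x \<in> V" "V \<subseteq> U" "\<And>n y. \<lbrakk>x \<in> Z n; y \<in> V; y \<in> Z n\<rbrakk> \<Longrightarrow> y = x"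
  proof (cases "\<exists>n. x \<in> Z n")
    case True
    then obtain n where n: "x \<in> Z n"
      by blast
    obtain V where "openin T V" "x \<in> V" "V \<subseteq> U" "V \<inter> Z n \<subseteq> {x}"
      using derived_set_of_emptyD[OF Z(1) U] by metis
    moreover have "m = n" if "x \<in> Z m" for m
      using n that Z(2) unfolding disjoint_family_on_def by blast
    ultimately show thesis
      using that by blast
  qed (use U that in blast)
  obtain C where C: "openin T C" "x \<in> C" "C \<subseteq> V" "ord_convex C"
    using convex_nhd[OF V(1,2)] by blast
  obtain w where w: "w \<in> C" "x \<sqsubset> w"
    using right_isolated_in_right_cuts[OF C(1,2)] False by blast
  then have "w \<in> T closure_of (\<Union>n. Z n)" and w': "w \<in> C \<inter> {y \<in> topspace T. x \<sqsubset> y}"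
    using dense C(1) openin_subset by blast+
  moreover have "openin T (C \<inter> {y \<in> topspace T. x \<sqsubset> y})"
    using C(1) openin_above[OF x] by blast
  ultimately have "\<exists>d. d \<in> (\<Union>n. Z n) \<and> d \<in> C \<inter> {y \<in> topspace T. x \<sqsubset> y}"
    by (simp only: in_closure_of)
  then obtain m d where d: "d \<in> Z m" "d \<in> C" "x \<sqsubset> d"
    by blast
  have "x \<notin> Z m"
    using V(4)[of m d] d C(3) by auto
  moreover have "y \<in> U" if "y \<in> topspace T" "x \<sqsubseteq> y \<and> y \<sqsubseteq> d" for y
    using ord_convexD[OF C(4,2) d(2)] that C(3) V(3) by blast
  ultimately show ?thesis
    using d by blast
qed

text \<open>One half of being screened; the reversed order gives the other. The complement of
  \<open>Z m\<close> serves as the neighbourhood, and if \<open>x\<close> is itself a right cut then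
  \<open>d = x\<close> works.\<close>

lemma screened_from_right:
  fixes Z :: "nat \<Rightarrow> 'a set"
  assumes Z: "\<And>n. T derived_set_of Z n = {}" "disjoint_family Z" "\<And>n. Z n \<subseteq> topspace T"
    and dense: "T closure_of (\<Union>n. Z n) = topspace T"
    and cuts: "right_cuts \<subseteq> (\<Union>n. Z n)"
    and x: "x \<in> topspace T" "x \<notin> Z m"
  shows "\<exists>i. \<exists>d\<in>Z i. x \<sqsubseteq> d \<and> (\<forall>z\<in>Z m. x \<sqsubset> z \<longrightarrow> d \<sqsubset> z)"
proof -
  have "closedin T (Z m)"
    using derived_set_subset[OF Z(3), of m] Z(1) by simp
  then have "openin T (topspace T - Z m)" "x \<in> topspace T - Z m"
    using x by auto
  from separation_from_right[OF Z(1,2) dense cuts this] show ?thesis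
  proof (elim disjE exE conjE bexE)
    fix n d
    assume d: "d \<in> Z n" "x \<sqsubset> d" "\<forall>y\<in>topspace T. x \<sqsubseteq> y \<and> y \<sqsubseteq> d \<longrightarrow> y \<in> topspace T - Z m"
    have "d \<sqsubset> z" if "z \<in> Z m" "x \<sqsubset> z" for z
      using d(3) that Z(3) leI less_imp_le by blast
    then show ?thesis
      using d less_imp_le by blast
  qed blast
qed

theorem metrizable_if_sigma_discrete:
  assumes \<D>: "countable \<D>" "\<And>D. D \<in> \<D> \<Longrightarrow> D \<subseteq> topspace T \<and> T derived_set_of D = {}"
    and dense: "T closure_of \<Union>\<D> = topspace T"
    and cuts: "left_cuts \<subseteq> \<Union>\<D>" "right_cuts \<subseteq> \<Union>\<D>"
  shows "metrizable_space T"
proof -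
  interpret dual: go_order "\<lambda>x y. y \<sqsubseteq> x" "\<lambda>x y. y \<sqsubset> x" T
    by (rule dual_go_order)
  have dual_cuts: "dual.right_cuts = left_cuts"
    by (simp add: dual.right_cuts_def left_cuts_def)
  \<comment> \<open>The empty set is added so that an enumeration exists even if \<open>\<D>\<close>
    is empty. Disjointing it then puts each point into at most one layer.\<close>
  define S where "S = from_nat_into (insert {} \<D>)"
  have range_S: "range S = insert {} \<D>"
    using \<D>(1) by (simp add: S_def range_from_nat_into)
  define Z where "Z = disjointed S"
  have "S n \<subseteq> topspace T \<and> T derived_set_of S n = {}" for n
  proof -
    have "S n \<in> insert {} \<D>"
      using range_S by blast
    then show ?thesis
      using \<D>(2)[of "S n"] by auto
  qed
  then have Z: "Z n \<subseteq> topspace T" "T derived_set_of Z n = {}" for n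
    using disjointed_subset[of S n] derived_set_of_mono[of "Z n" "S n" T] unfolding Z_def by blast+
  have disj: "disjoint_family Z"
    by (simp add: Z_def disjoint_family_disjointed)
  have UN_Z: "(\<Union>n. Z n) = \<Union>\<D>"
    by (simp add: Z_def UN_disjointed_eq range_S)
  have dense_Z: "T closure_of (\<Union>n. Z n) = topspace T"
    by (simp add: UN_Z dense)
  have cuts_Z: "right_cuts \<subseteq> (\<Union>n. Z n)" "dual.right_cuts \<subseteq> (\<Union>n. Z n)"
    by (simp_all add: UN_Z cuts dual_cuts)
  have Z2: "Z i \<union> Z j \<subseteq> topspace T" "T derived_set_of (Z i \<union> Z j) = {}" for i j
    using Z by (auto simp: derived_set_of_Un)
  define F where "F m i j = (SOME f. continuous_map T euclideanreal f \<and>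
      (\<forall>x. 0 \<le> f x \<and> f x \<le> 1/2) \<and> (\<forall>x\<in>Z m. f x = 0) \<and> (\<forall>x\<in>screened (Z m) (Z i \<union> Z j). f x = 1/2))"
    for m i j
  have F_spec: "continuous_map T euclideanreal (F m i j) \<and> (\<forall>x. 0 \<le> F m i j x \<and> F m i j x \<le> 1/2) \<and>
      (\<forall>x\<in>Z m. F m i j x = 0) \<and> (\<forall>x\<in>screened (Z m) (Z i \<union> Z j). F m i j x = 1/2)" for m i j
    unfolding F_def by (rule someI_ex[OF screening_function[OF Z2 Z]])
  have F: "continuous_map T euclideanreal (F m i j)" "0 \<le> F m i j x \<and> F m i j x \<le> 1/2"
    "x \<in> Z m \<Longrightarrow> F m i j x = 0" "x \<in> screened (Z m) (Z i \<union> Z j) \<Longrightarrow> F m i j x = 1/2" for m i j x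
    using F_spec[of m i j] by simp_all
  define \<rho> where "\<rho> = (\<lambda>(m, i, j). hedgehog (position (Z m)) (F m i j))"
  \<comment> \<open>With constant height \<open>1/2\<close> a hedgehog is two-valued:
    \<open>0\<close> inside a class and \<open>1\<close> across. A right cut in \<open>Z n\<close>
    thus has distance \<open>1\<close> from everything to its right.\<close>
  define rc where "rc n = hedgehog (\<lambda>x. {z \<in> Z n \<inter> right_cuts. z \<sqsubset> x}) (\<lambda>_. 1/2)" for n
  define lc where "lc n = hedgehog (\<lambda>x. {z \<in> Z n \<inter> left_cuts. x \<sqsubset> z}) (\<lambda>_. 1/2)" for n
  define \<P> where "\<P> = range \<rho> \<union> range rc \<union> range lc"
  have screened: "\<exists>i j. x \<in> screened (Z m) (Z i \<union> Z j)" if x: "x \<in> topspace T" "x \<notin> Z m" for x m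
  proof -
    obtain i d where "d \<in> Z i" "x \<sqsubseteq> d" "\<forall>z\<in>Z m. x \<sqsubset> z \<longrightarrow> d \<sqsubset> z"
      using screened_from_right[OF Z(2) disj Z(1) dense_Z cuts_Z(1) x] by blast
    moreover obtain j e where "e \<in> Z j" "e \<sqsubseteq> x" "\<forall>z\<in>Z m. z \<sqsubset> x \<longrightarrow> z \<sqsubset> e"
      using dual.screened_from_right[OF Z(2) disj Z(1) dense_Z cuts_Z(2) x] by blast
    ultimately have "x \<in> screened (Z m) (Z i \<union> Z j)"
      using x unfolding screened_def by blast
    then show ?thesis
      by blast
  qed
  have from_right: "\<exists>\<phi>\<in>\<P>. \<forall>y\<in>topspace T. x \<sqsubseteq> y \<and> \<phi> x y < 1/2 \<longrightarrow> y \<in> U"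
    if U: "openin T U" "x \<in> U" for U x
    using separation_from_right[OF Z(2) disj dense_Z cuts_Z(1) U]
  proof (elim disjE exE conjE bexE)
    fix n
    assume n: "x \<in> Z n \<inter> right_cuts"
    have "y \<in> U" if "x \<sqsubseteq> y" "rc n x y < 1/2" for y
    proof -
      have "\<not> x \<sqsubset> y"
      proof
        assume "x \<sqsubset> y"
        then have "{z \<in> Z n \<inter> right_cuts. z \<sqsubset> x} \<noteq> {z \<in> Z n \<inter> right_cuts. z \<sqsubset> y}"
          using n by auto
        with that(2) show False
          by (simp add: rc_def hedgehog_def)
      qed
      with that(1) have "x = y"
        by (simp add: less_le)
      with U(2) show ?thesis
        by simp
    qed
    then show ?thesis
      by (intro bexI[of _ "rc n"]) (auto simp: \<P>_def)
  next
    fix m d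
    assume m: "x \<notin> Z m" and d: "d \<in> Z m" "x \<sqsubset> d" "\<forall>y\<in>topspace T. x \<sqsubseteq> y \<and> y \<sqsubseteq> d \<longrightarrow> y \<in> U"
    have "x \<in> topspace T"
      using U openin_subset by blast
    then obtain i j where ij: "x \<in> screened (Z m) (Z i \<union> Z j)"
      using screened m by blast
    have "y \<in> U" if y: "y \<in> topspace T" "x \<sqsubseteq> y" "\<rho> (m, i, j) x y < 1/2" for y
    proof -
      \<comment> \<open>Since \<open>x\<close> has height \<open>1/2\<close>, a different spine
        would put \<open>y\<close> at distance at least \<open>1/2\<close>.\<close>
      have "position (Z m) x = position (Z m) y"
        using y(3) F(2)[of m i j y] F(4)[OF ij] by (auto simp: \<rho>_def hedgehog_def split: if_splits)
      then have "y \<sqsubset> d"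
        using position_eqD d(1,2) by blast
      then show ?thesis
        using d(3) y less_imp_le by blast
    qed
    then show ?thesis
      by (intro bexI[of _ "\<rho> (m, i, j)"]) (auto simp: \<P>_def)
  qed
  have from_left: "\<exists>\<phi>\<in>\<P>. \<forall>y\<in>topspace T. y \<sqsubseteq> x \<and> \<phi> x y < 1/2 \<longrightarrow> y \<in> U"
    if U: "openin T U" "x \<in> U" for U x
    using dual.separation_from_right[OF Z(2) disj dense_Z cuts_Z(2) U]
  proof (elim disjE exE conjE bexE)
    fix n
    assume "x \<in> Z n \<inter> dual.right_cuts"
    then have n: "x \<in> Z n \<inter> left_cuts"
      by (simp add: dual_cuts)
    have "y \<in> U" if "y \<sqsubseteq> x" "lc n x y < 1/2" for y
    proof -
      have "\<not> y \<sqsubset> x"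
      proof
        assume "y \<sqsubset> x"
        then have "{z \<in> Z n \<inter> left_cuts. x \<sqsubset> z} \<noteq> {z \<in> Z n \<inter> left_cuts. y \<sqsubset> z}"
          using n by auto
        with that(2) show False
          by (simp add: lc_def hedgehog_def)
      qed
      with that(1) have "x = y"
        by (simp add: less_le)
      with U(2) show ?thesis
        by simp
    qed
    then show ?thesis
      by (intro bexI[of _ "lc n"]) (auto simp: \<P>_def)
  next
    fix m d
    assume m: "x \<notin> Z m" and d: "d \<in> Z m" "d \<sqsubset> x" "\<forall>y\<in>topspace T. y \<sqsubseteq> x \<and> d \<sqsubseteq> y \<longrightarrow> y \<in> U"
    have "x \<in> topspace T"
      using U openin_subset by blast
    then obtain i j where ij: "x \<in> screened (Z m) (Z i \<union> Z j)"
      using screened m by blast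
    have "y \<in> U" if y: "y \<in> topspace T" "y \<sqsubseteq> x" "\<rho> (m, i, j) x y < 1/2" for y
    proof -
      have "position (Z m) x = position (Z m) y"
        using y(3) F(2)[of m i j y] F(4)[OF ij] by (auto simp: \<rho>_def hedgehog_def split: if_splits)
      then have "d \<sqsubset> y"
        using position_eqD d(1,2) by blast
      then show ?thesis
        using d(3) y less_imp_le by blast
    qed
    then show ?thesis
      by (intro bexI[of _ "\<rho> (m, i, j)"]) (auto simp: \<P>_def)
  qed
  have cut_sub: "T derived_set_of (Z n \<inter> A) = {}" for n A
    using derived_set_of_mono[of "Z n \<inter> A" "Z n" T] Z(2) by blast
  have cont: "continuous_pseudometric T (\<rho> (m, i, j))" for m i j
  proof -
    have "F m i j x = 0 \<or> (\<exists>U. openin T U \<and> x \<in> U \<and> (\<forall>y\<in>U. position (Z m) y = position (Z m) x))"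
      if "x \<in> topspace T" for x
      using F(3) position_locally_constant[OF Z that] by blast
    then show ?thesis
      using F by (auto simp: \<rho>_def intro!: continuous_pseudometric_hedgehog)
  qed
  have cont_rc: "continuous_pseudometric T (rc n)" for n
    unfolding rc_def using cuts_below_locally_constant[of "Z n \<inter> right_cuts", OF _ cut_sub]
    by (intro continuous_pseudometric_hedgehog disjI2) auto
  have cont_lc: "continuous_pseudometric T (lc n)" for n
    unfolding lc_def using dual.cuts_below_locally_constant[of "Z n \<inter> left_cuts", OF _ cut_sub]
    by (intro continuous_pseudometric_hedgehog disjI2) (auto simp: dual_cuts)
  show ?thesis
  proof (rule metrizable_space_if_pseudometrics[OF Hausdorff, of \<P>])
    show "countable \<P>" "\<P> \<noteq> {}"
      by (auto simp: \<P>_def)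
    show "continuous_pseudometric T \<phi>" if "\<phi> \<in> \<P>" for \<phi>
      using that cont cont_rc cont_lc by (auto simp: \<P>_def)
    show "\<phi> x y \<le> 1" if "\<phi> \<in> \<P>" for \<phi> x y
      using that F(2) by (auto simp: \<P>_def \<rho>_def rc_def lc_def intro!: hedgehog_le_1)
    show "\<exists>\<phi>\<in>\<P>. \<exists>\<psi>\<in>\<P>. \<exists>e>0. \<forall>y\<in>topspace T. \<phi> x y < e \<and> \<psi> x y < e \<longrightarrow> y \<in> U"
      if U: "openin T U" "x \<in> U" for U x
    proof -
      obtain \<phi> \<psi> where *: "\<phi> \<in> \<P>" "\<psi> \<in> \<P>"
        "\<forall>y\<in>topspace T. x \<sqsubseteq> y \<and> \<phi> x y < 1/2 \<longrightarrow> y \<in> U"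
        "\<forall>y\<in>topspace T. y \<sqsubseteq> x \<and> \<psi> x y < 1/2 \<longrightarrow> y \<in> U"
        using from_right[OF U] from_left[OF U] by blast
      \<comment> \<open>Each \<open>y\<close> lies on one side of \<open>x\<close>, where one of the
        two pseudometrics decides.\<close>
      then have "\<forall>y\<in>topspace T. \<phi> x y < 1/2 \<and> \<psi> x y < 1/2 \<longrightarrow> y \<in> U"
        using linear by blast
      with *(1,2) show ?thesis
        by (intro bexI[of _ \<phi>] bexI[of _ \<psi>] exI[of _ "1/2"]) auto
    qed
  qed
qed

end

text \<open>Reversing the order exchanges left and right cuts but leaves the topology, the dense set
  and the operator unchanged. So \<open>left_cuts_covered\<close> is applied in both directions, and
  the dense set is enlarged by the two families it yields.\<close>

theorem theorem3p3:
  fixes T :: "'a::linorder topology"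
  assumes "GO_space T"
    and "\<exists>S. sigma_closed_discrete_in T S \<and> T closure_of S = topspace T"
    and "\<exists>r. monotone_closure_preserving_operator T r"
  shows "metrizable_space T"
proof -
  interpret go_order "(\<le>)" "(<)" T
  proof
    show "Hausdorff_space T"
      using assms(1) by (simp add: GO_space_def)
    fix U p
    assume U: "openin T U" "p \<in> U"
    obtain \<B> where \<B>: "\<And>C. C \<in> \<B> \<Longrightarrow> order_convex_in (topspace T) C"
      "openin T = arbitrary union_of (\<lambda>C. C \<in> \<B>)"
      using assms(1) by (auto simp: GO_space_def)
    have open_iff: "openin T V \<longleftrightarrow> (\<exists>\<U>\<subseteq>\<B>. \<Union>\<U> = V)" for V
      by (simp add: \<B>(2) union_of_def arbitrary_def)
    obtain \<U> where "\<U> \<subseteq> \<B>" "\<Union>\<U> = U"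
      using U(1) open_iff[of U] by blast
    then obtain C where C: "C \<in> \<B>" "p \<in> C" "C \<subseteq> U"
      using U(2) by blast
    have "{C} \<subseteq> \<B>" "\<Union>{C} = C"
      using C(1) by simp_all
    then have "openin T C"
      using open_iff[of C] by blast
    moreover have "\<forall>a\<in>C. \<forall>b\<in>C. \<forall>y\<in>topspace T. a \<le> y \<longrightarrow> y \<le> b \<longrightarrow> y \<in> C"
      using \<B>(1)[OF C(1)] unfolding order_convex_in_def imp_conjL[symmetric] by (rule conjunct2)
    ultimately show "\<exists>C. openin T C \<and> p \<in> C \<and> C \<subseteq> U \<and>
        (\<forall>a\<in>C. \<forall>b\<in>C. \<forall>y\<in>topspace T. a \<le> y \<longrightarrow> y \<le> b \<longrightarrow> y \<in> C)"
      using C(2,3) by blast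
  qed
  interpret dual: go_order "\<lambda>x y. y \<le> x" "\<lambda>x y. y < x" T
    by (rule dual_go_order)
  obtain \<D> where \<D>: "countable \<D>" "\<And>D. D \<in> \<D> \<Longrightarrow> closed_discrete_in T D"
    "T closure_of \<Union>\<D> = topspace T"
    using assms(2) by (auto simp: sigma_closed_discrete_in_def)
  have sparse: "D \<subseteq> topspace T \<and> T derived_set_of D = {}" if "D \<in> \<D>" for D
    using derived_set_of_closed_discrete_in[OF \<D>(2)[OF that]] by blast
  obtain r where r: "monotone_closure_preserving_operator T r"
    using assms(3) by blast
  obtain \<L> where \<L>: "countable \<L>" "\<forall>S\<in>\<L>. S \<subseteq> topspace T \<and> T derived_set_of S = {}" "left_cuts \<subseteq> \<Union>\<L>"
    using left_cuts_covered[OF r \<D>(1) sparse \<D>(3)] by blast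
  have "dual.left_cuts = right_cuts"
    by (simp add: dual.left_cuts_def right_cuts_def)
  then obtain \<R> where \<R>: "countable \<R>" "\<forall>S\<in>\<R>. S \<subseteq> topspace T \<and> T derived_set_of S = {}" "right_cuts \<subseteq> \<Union>\<R>"
    using dual.left_cuts_covered[OF r \<D>(1) sparse \<D>(3)] by auto
  show ?thesis
  proof (rule metrizable_if_sigma_discrete)
    show "countable (\<D> \<union> \<L> \<union> \<R>)"
      using \<D>(1) \<L>(1) \<R>(1) by simp
    show "D \<subseteq> topspace T \<and> T derived_set_of D = {}" if "D \<in> \<D> \<union> \<L> \<union> \<R>" for D
      using that sparse[of D] \<L>(2) \<R>(2) by (elim UnE) simp_all
    show "T closure_of \<Union>(\<D> \<union> \<L> \<union> \<R>) = topspace T"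
    proof (rule subset_antisym[OF closure_of_subset_topspace])
      have "T closure_of \<Union>\<D> \<subseteq> T closure_of \<Union>(\<D> \<union> \<L> \<union> \<R>)"
        by (intro closure_of_mono) blast
      then show "topspace T \<subseteq> T closure_of \<Union>(\<D> \<union> \<L> \<union> \<R>)"
        by (simp only: \<D>(3))
    qed
    show "left_cuts \<subseteq> \<Union>(\<D> \<union> \<L> \<union> \<R>)" "right_cuts \<subseteq> \<Union>(\<D> \<union> \<L> \<union> \<R>)"
      using \<L>(3) \<R>(3) by (simp_all add: le_supI1 le_supI2)
  qed
qed

end
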